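(* Let $\alpha\in\mathbb Z^2\setminus I(\mathcal A)$. Then: (i) $\Psi^{\mathcal A}_d(\alpha;x)$ and $\Psi^{\mathcal A}_0(\alpha;x)$ are (possibly zero) solutions of the $\mathcal A$-hypergeometric system with exponent $\alpha$. (ii) For any $u\in\mathbb N^{\Lambda}$, $D_u\big(\Psi^{\mathcal A}_d(\alpha;x)\big)=\Psi^{\mathcal A}_d(\alpha-\mathcal A u;x)$ and $D_u\big(\Psi^{\mathcal A}_0(\alpha;x)\big)=\Psi^{\mathcal A}_0(\alpha-\mathcal A u;x)$. (iii) The functions $\Psi^{\mathcal A}_d(\alpha;x)$ and $\Psi^{\mathcal A}_0(\alpha;x)$ span the complex vector space of Laurent polynomial solutions of the $\mathcal A$-hypergeometric system with exponent $\alpha$.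
   Context: Setting: $m\ge 1$ and $0<k_1<\dots<k_m<d$ are integers with $\gcd(k_1,\dots,k_m,d)=1$; $\Lambda=\{0,k_1,\dots,k_m,d\}$, and all $(m+2)$-tuples are indexed by $\Lambda$. $\mathbb N=\{0,1,2,\dots\}$. $\mathcal A$ is the $2\times(m+2)$ integer matrix whose columns are $(1,j)^T$, $j\in\Lambda$. Variables $x=(x_j)_{j\in\Lambda}$; for $u\in\mathbb N^{\Lambda}$, $D_u=\prod_{j\in\Lambda}(\partial/\partial x_j)^{u_j}$. The $\mathcal A$-hypergeometric system with exponent $\alpha=(\alpha_1,\alpha_2)$ consists of the equations $\prod_{v_j>0}(\partial/\partial x_j)^{v_j}\varphi=\prod_{v_j<0}(\partial/\partial x_j)^{-v_j}\varphi$ for all $v\in\mathbb Z^{\Lambda}$ with $\mathcal A v=0$, together with $\sum_{j\in\Lambda}x_j\,\partial\varphi/\partial x_j=\alpha_1\varphi$ and $\sum_{j\in\Lambda}j\,x_j\,\partial\varphi/\partial x_j=\alpha_2\varphi$. $I(\mathcal A)=\mathcal A\cdot\mathbb N^{\Lambda}\subset\mathbb Z^2$. Let $\mathcal B$ be the matrix obtained from $\mathcal A$ by deleting the column $(1,d)^T$, $\mathcal C$ the matrix obtained by deleting the column $(1,0)^T$; $x'=(x_0,x_{k_1},\dots,x_{k_m})$, $\tilde x=(x_{k_1},\dots,x_{k_m},x_d)$. For $\mathcal M\in\{\mathcal B,\mathcal C\}$ and $\beta\in\mathbb Z^2$, the hypergeometric polynomial is $\Phi^{\mathcal M}(\beta;y)=\sum_{u}\prod_j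 y_j^{u_j}/u_j!$, the sum over tuples $u\in\mathbb N^{m+1}$ with $\mathcal M u=\beta$ (zero if there are none), with $y=x'$ for $\mathcal B$ and $y=\tilde x$ for $\mathcal C$. For $\alpha\in\mathbb Z^2$ define the (finite) sums $$\Psi^{\mathcal A}_d(\alpha;x)=\sum_{r\ge1}(-1)^r(r-1)!\,\frac{\Phi^{\mathcal B}(\alpha+r(1,d);x')}{x_d^r},\qquad \Psi^{\mathcal A}_0(\alpha;x)=\sum_{r\ge1}(-1)^r(r-1)!\,\frac{\Phi^{\mathcal C}(\alpha+r(1,0);\tilde x)}{x_0^r}.$$ *)

theory Defs
  imports
    "HOL-Analysis.Analysis"
    "HOL-Library.Poly_Mapping"
    "HOL-Library.Product_Plus"
begin

text \<open>
  Laurent polynomials are elements of the group algebra of the group of finitely supported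
  exponent vectors \<^typ>\<open>nat \<Rightarrow>\<^sub>0 int\<close>: the variables are indexed by all natural numbers, and
  \<open>laurent_polys S\<close> is the subring in which only the variables with index in \<open>S\<close> occur.
\<close>

type_synonym laurent = "(nat \<Rightarrow>\<^sub>0 int) \<Rightarrow>\<^sub>0 complex"

definition laurent_polys :: "nat set \<Rightarrow> laurent set" where
  "laurent_polys S = {p. \<forall>e \<in> Poly_Mapping.keys p. Poly_Mapping.keys e \<subseteq> S}"

text \<open>The power $x_j^n$, for an arbitrary integer $n$.\<close>

definition xpow :: "nat \<Rightarrow> int \<Rightarrow> laurent" where
  "xpow j n = Poly_Mapping.single (Poly_Mapping.single j n) 1"

definition lscale :: "complex \<Rightarrow> laurent \<Rightarrow> laurent" where
  "lscale c p = Poly_Mapping.single 0 c * p"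

global_interpretation laurent: vector_space lscale
  by unfold_locales
    (simp_all add: lscale_def distrib_left distrib_right single_add mult_single
      flip: mult.assoc)

definition pderiv_var :: "nat \<Rightarrow> laurent \<Rightarrow> laurent" where
  "pderiv_var j p =
     (\<Sum>e\<in>Poly_Mapping.keys p. Poly_Mapping.single (e - Poly_Mapping.single j 1)
        (of_int (Poly_Mapping.lookup e j) * Poly_Mapping.lookup p e))"

text \<open>
  $\prod_{j \in S} (\partial/\partial x_j)^{u_j}$; the factors commute, they are composed along
  the increasing enumeration of the finite set \<open>S\<close>.
\<close>

definition Dop :: "nat set \<Rightarrow> (nat \<Rightarrow> nat) \<Rightarrow> laurent \<Rightarrow> laurent" where
  "Dop S u = fold (\<lambda>j. pderiv_var j ^^ u j) (sorted_list_of_set S)"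

text \<open>
  The product $\mathcal M v$, where $\mathcal M$ is the matrix with columns $(1,j)^T$, $j \in S$.
  Only the values of \<open>v\<close> on \<open>S\<close> matter.
\<close>

definition mat_app :: "nat set \<Rightarrow> (nat \<Rightarrow> int) \<Rightarrow> int \<times> int" where
  "mat_app S v = (\<Sum>j\<in>S. v j, \<Sum>j\<in>S. int j * v j)"

definition index_set :: "nat \<Rightarrow> (nat \<Rightarrow> nat) \<Rightarrow> nat \<Rightarrow> nat set" where
  "index_set m k d = {0} \<union> k ` {1..m} \<union> {d}"

definition semigroup_I :: "nat set \<Rightarrow> (int \<times> int) set" where
  "semigroup_I S = {mat_app S (int \<circ> u) | u :: nat \<Rightarrow> nat. True}"

definition hypergeometric_solution :: "nat set \<Rightarrow> int \<times> int \<Rightarrow> laurent \<Rightarrow> bool" where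
  "hypergeometric_solution S \<alpha> \<phi> \<longleftrightarrow>
     (\<forall>v :: nat \<Rightarrow> int. mat_app S v = 0 \<longrightarrow>
        Dop {j\<in>S. v j > 0} (\<lambda>j. nat (v j)) \<phi> = Dop {j\<in>S. v j < 0} (\<lambda>j. nat (- v j)) \<phi>) \<and>
     (\<Sum>j\<in>S. xpow j 1 * pderiv_var j \<phi>) = lscale (of_int (fst \<alpha>)) \<phi> \<and>
     (\<Sum>j\<in>S. lscale (of_nat j) (xpow j 1 * pderiv_var j \<phi>)) = lscale (of_int (snd \<alpha>)) \<phi>"

text \<open>Tuples of natural numbers indexed by \<open>S\<close> are the elements of \<open>S \<rightarrow>\<^sub>E UNIV\<close>.\<close>

definition hyper_tuples :: "nat set \<Rightarrow> int \<times> int \<Rightarrow> (nat \<Rightarrow> nat) set" where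
  "hyper_tuples S \<beta> = {u \<in> S \<rightarrow>\<^sub>E UNIV. mat_app S (int \<circ> u) = \<beta>}"

definition hyper_poly :: "nat set \<Rightarrow> int \<times> int \<Rightarrow> laurent" where
  "hyper_poly S \<beta> = (\<Sum>u\<in>hyper_tuples S \<beta>.
     \<Prod>j\<in>S. lscale (1 / fact (u j)) (xpow j (int (u j))))"

text \<open>
  The sum over \<open>r\<close> ranges over those $r \ge 1$ whose summand is nonzero; see
  \<open>finite_Psi_d\<close> and \<open>finite_Psi_0\<close> below for the finiteness.
\<close>

definition Psi :: "nat set \<Rightarrow> nat \<Rightarrow> int \<times> int \<Rightarrow> laurent" where
  "Psi S i \<alpha> = (\<Sum>r | 1 \<le> r \<and> hyper_poly (S - {i}) (\<alpha> + (int r, int r * int i)) \<noteq> 0.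
     lscale ((-1) ^ r * fact (r - 1))
       (hyper_poly (S - {i}) (\<alpha> + (int r, int r * int i)) * xpow i (- int r)))"

lemma finite_hyper_tuples:
  assumes "finite S"
  shows "finite (hyper_tuples S \<beta>)"
proof (rule finite_subset)
  show "hyper_tuples S \<beta> \<subseteq> S \<rightarrow>\<^sub>E {..nat (fst \<beta>)}"
  proof
    fix u assume u: "u \<in> hyper_tuples S \<beta>"
    then have s: "(\<Sum>j\<in>S. int (u j)) = fst \<beta>"
      by (auto simp: hyper_tuples_def mat_app_def)
    have "u j \<le> nat (fst \<beta>)" if "j \<in> S" for j
    proof -
      have "int (u j) \<le> (\<Sum>j\<in>S. int (u j))"
        by (rule member_le_sum) (use assms that in auto)
      then show ?thesis using s by linarith
    qed
    with u show "u \<in> S \<rightarrow>\<^sub>E {..nat (fst \<beta>)}"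
      by (auto simp: hyper_tuples_def PiE_def Pi_def)
  qed
  show "finite (S \<rightarrow>\<^sub>E {..nat (fst \<beta>)})"
    using assms by (intro finite_PiE) auto
qed

lemma hyper_poly_nonzeroE:
  assumes "hyper_poly S \<beta> \<noteq> 0"
  obtains u :: "nat \<Rightarrow> nat" where "(\<Sum>j\<in>S. int (u j)) = fst \<beta>"
    and "(\<Sum>j\<in>S. int j * int (u j)) = snd \<beta>"
proof -
  from assms have "hyper_tuples S \<beta> \<noteq> {}"
    by (auto simp: hyper_poly_def)
  then obtain u where "mat_app S (int \<circ> u) = \<beta>"
    by (auto simp: hyper_tuples_def)
  then show ?thesis
    by (intro that[of u]) (auto simp: mat_app_def)
qed

lemma finite_Psi_d:
  assumes "\<And>j. j \<in> S \<Longrightarrow> j \<le> d"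
  shows "finite {r. 1 \<le> r \<and> hyper_poly (S - {d}) (\<alpha> + (int r, int r * int d)) \<noteq> 0}"
proof (rule finite_subset)
  show "{r. 1 \<le> r \<and> hyper_poly (S - {d}) (\<alpha> + (int r, int r * int d)) \<noteq> 0}
          \<subseteq> {..nat (int d * fst \<alpha> - snd \<alpha> - fst \<alpha>)}"
  proof safe
    fix r assume "hyper_poly (S - {d}) (\<alpha> + (int r, int r * int d)) \<noteq> 0"
    then obtain u :: "nat \<Rightarrow> nat" where
      u1: "(\<Sum>j\<in>S - {d}. int (u j)) = fst \<alpha> + int r" and
      u2: "(\<Sum>j\<in>S - {d}. int j * int (u j)) = snd \<alpha> + int r * int d"
      by (rule hyper_poly_nonzeroE) auto
    have "(\<Sum>j\<in>S - {d}. int j * int (u j)) + (\<Sum>j\<in>S - {d}. int (u j))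
            = (\<Sum>j\<in>S - {d}. (int j + 1) * int (u j))"
      by (simp add: sum.distrib algebra_simps)
    also have "\<dots> \<le> (\<Sum>j\<in>S - {d}. int d * int (u j))"
      using assms by (intro sum_mono mult_right_mono) (force simp: le_less)+
    also have "\<dots> = int d * (\<Sum>j\<in>S - {d}. int (u j))"
      by (simp add: sum_distrib_left)
    finally show "r \<le> nat (int d * fst \<alpha> - snd \<alpha> - fst \<alpha>)"
      unfolding u1 u2 by (simp add: algebra_simps)
  qed
qed simp

lemma finite_Psi_0:
  "finite {r. 1 \<le> r \<and> hyper_poly (S - {0}) (\<alpha> + (int r, int r * int 0)) \<noteq> 0}"
proof (rule finite_subset)
  show "{r. 1 \<le> r \<and> hyper_poly (S - {0}) (\<alpha> + (int r, int r * int 0)) \<noteq> 0}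
          \<subseteq> {..nat (snd \<alpha> - fst \<alpha>)}"
  proof safe
    fix r assume "hyper_poly (S - {0}) (\<alpha> + (int r, int r * int 0)) \<noteq> 0"
    then obtain u :: "nat \<Rightarrow> nat" where
      u1: "(\<Sum>j\<in>S - {0}. int (u j)) = fst \<alpha> + int r" and
      u2: "(\<Sum>j\<in>S - {0}. int j * int (u j)) = snd \<alpha>"
      by (rule hyper_poly_nonzeroE) auto
    have "(\<Sum>j\<in>S - {0}. 1 * int (u j)) \<le> (\<Sum>j\<in>S - {0}. int j * int (u j))"
      by (intro sum_mono mult_right_mono) auto
    then show "r \<le> nat (snd \<alpha> - fst \<alpha>)"
      using u1 u2 by simp
  qed
qed simp

end

theory Submission
  imports Defs
begin

text \<open>
  The proof compares coefficients. Put $\gamma(n) = 1/n!$ for $n \ge 0$ and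
  $\gamma(-r) = (-1)^r (r-1)!$ for $r \ge 1$ (\<open>divided_coeff\<close>); then $n\,\gamma(n) = \gamma(n-1)$
  for every integer $n \ne 0$, while the left-hand side vanishes for $n = 0$. Hence
  $\gamma(n) x^n$ is a divided power whose derivative is the preceding divided power, except that
  $n = 0$ is not carried to $n = -1$. In these terms $\Psi_i(\alpha)$, for $i \in \{0, d\}$, is the
  sum of $\prod_j \gamma(e_j) x_j^{e_j}$ over all integral $e$ with $\mathcal A e = \alpha$ whose
  negative support $\{j : e_j < 0\}$ is exactly $\{i\}$ (\<open>lookup_Psi\<close>).

  Differentiating such a sum shifts the exponents and annihilates exactly those terms whose negative
  support would grow. A term of $\Psi_i(\alpha - \mathcal A u)$ that does not arise in this way would
  come from an exponent over $\alpha$ without negative entries, and there is none because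
  $\alpha \notin I(\mathcal A)$. This gives the formula for the derivatives (\<open>Dop_Psi\<close>), and the
  hypergeometric equations follow from it.

  For the spanning statement, divide the coefficient of $x^e$ in a solution by
  $\prod_j \gamma(e_j)$. The equations force the quotient to be the same for all exponents with a
  common negative support, and to be zero at $e$ if another exponent over $\alpha$ has a strictly
  smaller negative support (\<open>solution_coeff_compare\<close>). Since a Laurent polynomial has only finitely
  many terms, it is enough to exhibit, for every exponent $e$ over $\alpha$ whose negative support is not
  $\{0\}$ or $\{d\}$ (nor empty, as $\alpha \notin I(\mathcal A)$), infinitely many exponents over
  $\alpha$ whose negative support is contained in that of $e$.
  They lie on the line $e + s\,((d-k)\,\epsilon_0 + k\,\epsilon_d - d\,\epsilon_k)$, where
  $\epsilon_j$ are the unit vectors: if some $e_k$ with $0 < k < d$ is negative, let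
  $s \to \infty$, and if the negative support is $\{0, d\}$, let $s \to -\infty$
  (\<open>solution_negative_support\<close>).
\<close>

section \<open>Coefficients of derivatives\<close>

lemma lookup_single_times:
  fixes p :: laurent
  shows "Poly_Mapping.lookup (Poly_Mapping.single a c * p) e = c * Poly_Mapping.lookup p (e - a)"
proof -
  have p: "p = (\<Sum>b\<in>Poly_Mapping.keys p. Poly_Mapping.single b (Poly_Mapping.lookup p b))"
    by (rule poly_mapping_eqI)
       (auto simp: lookup_sum lookup_single when_def in_keys_iff cong: if_cong)
  have eq: "a + b = e \<longleftrightarrow> b = e - a" for b
    by (auto simp: algebra_simps)
  show ?thesis
    by (subst p)
       (auto simp: sum_distrib_left mult_single lookup_sum lookup_single when_def eq in_keys_iff)
qed

lemma lookup_lscale: "Poly_Mapping.lookup (lscale c p) e = c * Poly_Mapping.lookup p e"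
  by (simp add: lscale_def lookup_single_times)

lemma lookup_xpow_times:
  "Poly_Mapping.lookup (xpow j n * p) e = Poly_Mapping.lookup p (e - Poly_Mapping.single j n)"
  by (simp add: xpow_def lookup_single_times)

lemma lookup_pderiv_var:
  "Poly_Mapping.lookup (pderiv_var j p) e =
     of_int (Poly_Mapping.lookup e j + 1) * Poly_Mapping.lookup p (e + Poly_Mapping.single j 1)"
proof -
  have eq: "b - Poly_Mapping.single j 1 = e \<longleftrightarrow> b = e + Poly_Mapping.single j 1"
    for b :: "nat \<Rightarrow>\<^sub>0 int"
    by (auto simp: algebra_simps)
  show ?thesis
    by (auto simp: pderiv_var_def lookup_sum lookup_single when_def eq in_keys_iff lookup_add)
qed

lemma lookup_pderiv_var_funpow:
  "Poly_Mapping.lookup ((pderiv_var j ^^ n) p) e =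
     pochhammer (of_int (Poly_Mapping.lookup e j + 1)) n *
     Poly_Mapping.lookup p (e + Poly_Mapping.single j (int n))"
proof (induction n arbitrary: e)
  case (Suc n)
  have "e + Poly_Mapping.single j 1 + Poly_Mapping.single j (int n) =
        e + Poly_Mapping.single j (int (Suc n))"
    by (simp add: add.assoc flip: single_add)
  then show ?case
    by (simp add: lookup_pderiv_var Suc.IH lookup_add lookup_single pochhammer_rec algebra_simps)
qed simp

definition exponent :: "nat set \<Rightarrow> (nat \<Rightarrow> nat) \<Rightarrow> nat \<Rightarrow>\<^sub>0 int" where
  "exponent T u = (\<Sum>j\<in>T. Poly_Mapping.single j (int (u j)))"

lemma lookup_exponent:
  assumes "finite T"
  shows "Poly_Mapping.lookup (exponent T u) j = (if j \<in> T then int (u j) else 0)"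
  using assms by (auto simp: exponent_def lookup_sum lookup_single when_def)

text \<open>
  The operator \<open>Dop\<close> composes along a list. Differentiation in one variable does not change the
  other entries of the exponent, so the factors collected on the way are those of the original
  exponent.
\<close>

lemma lookup_Dop:
  assumes "finite T"
  shows "Poly_Mapping.lookup (Dop T u p) e =
    (\<Prod>j\<in>T. pochhammer (of_int (Poly_Mapping.lookup e j + 1)) (u j)) *
    Poly_Mapping.lookup p (e + exponent T u)"
proof -
  have "Poly_Mapping.lookup (fold (\<lambda>j. pderiv_var j ^^ u j) xs p) e =
    (\<Prod>j\<in>set xs. pochhammer (of_int (Poly_Mapping.lookup e j + 1)) (u j)) *
    Poly_Mapping.lookup p (e + exponent (set xs) u)" if "distinct xs" for xs
    using that
  proof (induction xs arbitrary: p)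
    case (Cons x xs)
    have "e + exponent (set xs) u + Poly_Mapping.single x (int (u x)) =
          e + exponent (set (x # xs)) u"
      using Cons.prems by (simp add: exponent_def algebra_simps)
    then show ?case
      using Cons by (simp add: lookup_pderiv_var_funpow lookup_add lookup_exponent algebra_simps)
  qed (simp add: exponent_def)
  from this[of "sorted_list_of_set T"] assms show ?thesis
    by (simp add: Dop_def)
qed

section \<open>The hypergeometric system in terms of coefficients\<close>

lemma mat_app_add: "mat_app S (\<lambda>j. v j + w j) = mat_app S v + mat_app S w"
  by (simp add: mat_app_def sum.distrib distrib_left)

lemma mat_app_diff: "mat_app S (\<lambda>j. v j - w j) = mat_app S v - mat_app S w"
  by (simp add: mat_app_def sum_subtractf right_diff_distrib)

text \<open>
  The Euler operators act diagonally on monomials, so the last two equations only restrict which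
  exponents may occur.
\<close>

lemma hypergeometric_solution_iff:
  assumes "finite S"
  shows "hypergeometric_solution S \<alpha> \<phi> \<longleftrightarrow>
    (\<forall>v. mat_app S v = 0 \<longrightarrow>
       Dop {j\<in>S. v j > 0} (\<lambda>j. nat (v j)) \<phi> = Dop {j\<in>S. v j < 0} (\<lambda>j. nat (- v j)) \<phi>) \<and>
    (\<forall>e\<in>Poly_Mapping.keys \<phi>. mat_app S (Poly_Mapping.lookup e) = \<alpha>)"
proof -
  have euler: "Poly_Mapping.lookup (xpow j 1 * pderiv_var j \<phi>) e =
      of_int (Poly_Mapping.lookup e j) * Poly_Mapping.lookup \<phi> e" for j e
    by (simp add: lookup_xpow_times lookup_pderiv_var lookup_minus)
  have "Poly_Mapping.lookup (\<Sum>j\<in>S. xpow j 1 * pderiv_var j \<phi>) e =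
      of_int (fst (mat_app S (Poly_Mapping.lookup e))) * Poly_Mapping.lookup \<phi> e" for e
    by (simp add: lookup_sum euler mat_app_def sum_distrib_right)
  moreover have "Poly_Mapping.lookup (\<Sum>j\<in>S. lscale (of_nat j) (xpow j 1 * pderiv_var j \<phi>)) e =
      of_int (snd (mat_app S (Poly_Mapping.lookup e))) * Poly_Mapping.lookup \<phi> e" for e
    by (simp add: lookup_sum lookup_lscale euler mat_app_def sum_distrib_right mult.assoc)
  ultimately have
    "(\<Sum>j\<in>S. xpow j 1 * pderiv_var j \<phi>) = lscale (of_int (fst \<alpha>)) \<phi> \<and>
     (\<Sum>j\<in>S. lscale (of_nat j) (xpow j 1 * pderiv_var j \<phi>)) = lscale (of_int (snd \<alpha>)) \<phi> \<longleftrightarrow>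
     (\<forall>e\<in>Poly_Mapping.keys \<phi>. mat_app S (Poly_Mapping.lookup e) = \<alpha>)"
    by (auto simp: poly_mapping_eq_iff fun_eq_iff lookup_lscale in_keys_iff prod_eq_iff)
  then show ?thesis
    by (simp add: hypergeometric_solution_def)
qed

lemma subspace_hypergeometric_solutions:
  assumes "finite S"
  shows "laurent.subspace {\<phi> \<in> laurent_polys S. hypergeometric_solution S \<alpha> \<phi>}"
proof -
  have fin: "finite {j\<in>S. v j > 0}" "finite {j\<in>S. v j < 0}" for v :: "nat \<Rightarrow> int"
    using assms by auto
  have keys_scale: "Poly_Mapping.keys (lscale c p) \<subseteq> Poly_Mapping.keys p" for c p
    by (auto simp: in_keys_iff lookup_lscale)
  show ?thesis
    unfolding laurent.subspace_def
  proof (intro conjI ballI allI)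
    show "0 \<in> {\<phi> \<in> laurent_polys S. hypergeometric_solution S \<alpha> \<phi>}"
      by (auto simp: hypergeometric_solution_iff[OF assms] laurent_polys_def
          poly_mapping_eq_iff fun_eq_iff lookup_Dop[OF fin(1)] lookup_Dop[OF fin(2)])
  next
    fix p q
    assume "p \<in> {\<phi> \<in> laurent_polys S. hypergeometric_solution S \<alpha> \<phi>}"
      "q \<in> {\<phi> \<in> laurent_polys S. hypergeometric_solution S \<alpha> \<phi>}"
    then show "p + q \<in> {\<phi> \<in> laurent_polys S. hypergeometric_solution S \<alpha> \<phi>}"
      using Poly_Mapping.keys_add[of p q]
      by (auto simp: hypergeometric_solution_iff[OF assms] laurent_polys_def subset_iff
          poly_mapping_eq_iff fun_eq_iff lookup_Dop[OF fin(1)] lookup_Dop[OF fin(2)]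
          lookup_add distrib_left)
  next
    fix c p
    assume "p \<in> {\<phi> \<in> laurent_polys S. hypergeometric_solution S \<alpha> \<phi>}"
    then show "lscale c p \<in> {\<phi> \<in> laurent_polys S. hypergeometric_solution S \<alpha> \<phi>}"
      using keys_scale[of c p]
      by (auto simp: hypergeometric_solution_iff[OF assms] laurent_polys_def subset_iff
          poly_mapping_eq_iff fun_eq_iff lookup_Dop[OF fin(1)] lookup_Dop[OF fin(2)]
          lookup_lscale mult.left_commute[of _ c])
  qed
qed

section \<open>Divided powers and negative supports\<close>

text \<open>
  On negative integers the values are those that make the step rule below hold at every
  $n \ne 0$; the normalisation at $-1$ is the one of the sums \<^const>\<open>Psi\<close>.
\<close>

definition divided_coeff :: "int \<Rightarrow> complex" where
  "divided_coeff n =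
     (if n \<ge> 0 then 1 / fact (nat n) else (-1) ^ nat (- n) * fact (nat (- n) - 1))"

lemma divided_coeff_nonzero: "divided_coeff n \<noteq> 0"
  by (simp add: divided_coeff_def)

lemma divided_coeff_step:
  "of_int n * divided_coeff n = (if n = 0 then 0 else divided_coeff (n - 1))"
proof -
  consider "n = 0" | r where "n = int (Suc r)" | r where "n = - int (Suc r)"
    by (metis Suc_pred' int_cases2 of_nat_0 minus_zero not_gr_zero)
  then show ?thesis
  proof cases
    case (2 r)
    then have "nat n = Suc r" "nat (n - 1) = r"
      by auto
    with 2 show ?thesis
      by (simp add: divided_coeff_def del: of_nat_Suc)
  next
    case (3 r)
    then have "divided_coeff n = (-1) ^ Suc r * fact r"
      and "divided_coeff (n - 1) = (-1) ^ Suc (Suc r) * fact (Suc r)"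
      by (simp_all add: divided_coeff_def nat_add_distrib add.commute)
    moreover have "of_int n = - (of_nat (Suc r) :: complex)"
      using 3 by simp
    ultimately have "of_int n * divided_coeff n =
        - of_nat (Suc r) * ((-1) ^ Suc r * fact r)"
      and "divided_coeff (n - 1) = (-1) ^ Suc (Suc r) * fact (Suc r)"
      by simp_all
    with 3 show ?thesis
      by (simp add: algebra_simps)
  qed simp
qed

text \<open>
  The \<open>u\<close>-fold derivative of a divided power is again a divided power, unless the exponent descends
  through \<open>0\<close>: there a factor \<open>0\<close> appears.
\<close>

lemma pochhammer_divided_coeff:
  "pochhammer (of_int (n + 1)) u * divided_coeff (n + int u) =
     (if n < 0 \<and> 0 \<le> n + int u then 0 else divided_coeff n)"
proof (induction u)
  case (Suc u)
  have "pochhammer (of_int (n + 1)) (Suc u) * divided_coeff (n + int (Suc u)) =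
      pochhammer (of_int (n + 1)) u *
        (of_int (n + int (Suc u)) * divided_coeff (n + int (Suc u)))"
    by (simp add: pochhammer_Suc algebra_simps)
  also have "\<dots> = (if n + int (Suc u) = 0 then 0
      else pochhammer (of_int (n + 1)) u * divided_coeff (n + int u))"
    unfolding divided_coeff_step by simp
  finally show ?case
    using Suc.IH by auto
qed auto

definition negative_support :: "(nat \<Rightarrow>\<^sub>0 int) \<Rightarrow> nat set" where
  "negative_support e = {j. Poly_Mapping.lookup e j < 0}"

lemma negative_support_subset_keys: "negative_support e \<subseteq> Poly_Mapping.keys e"
  by (auto simp: negative_support_def in_keys_iff)

definition divided_monomial_coeff :: "nat set \<Rightarrow> (nat \<Rightarrow>\<^sub>0 int) \<Rightarrow> complex" where
  "divided_monomial_coeff S e = (\<Prod>j\<in>S. divided_coeff (Poly_Mapping.lookup e j))"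

lemma divided_monomial_coeff_nonzero: "finite S \<Longrightarrow> divided_monomial_coeff S e \<noteq> 0"
  by (simp add: divided_monomial_coeff_def divided_coeff_nonzero)

text \<open>
  An exponent entry descends through \<open>0\<close> precisely when the negative support grows. This is the
  only interaction between differential operators and divided monomials used below.
\<close>

lemma pochhammer_divided_monomial_coeff:
  assumes "finite S" and "T \<subseteq> S"
  shows "(\<Prod>j\<in>T. pochhammer (of_int (Poly_Mapping.lookup e j + 1)) (u j)) *
      divided_monomial_coeff S (e + exponent T u) =
    (if negative_support (e + exponent T u) = negative_support e
     then divided_monomial_coeff S e else 0)"
proof -
  have fT: "finite T"
    using assms finite_subset by blast
  let ?e = "Poly_Mapping.lookup e"
  have "(\<Prod>j\<in>T. pochhammer (of_int (?e j + 1)) (u j)) *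
      divided_monomial_coeff S (e + exponent T u) =
    (\<Prod>j\<in>T. pochhammer (of_int (?e j + 1)) (u j) * divided_coeff (?e j + int (u j))) *
      (\<Prod>j\<in>S - T. divided_coeff (?e j))"
    unfolding divided_monomial_coeff_def prod.subset_diff[OF assms(2,1)]
    using fT by (simp add: lookup_add lookup_exponent prod.distrib algebra_simps)
  also have "\<dots> = (\<Prod>j\<in>T. if ?e j < 0 \<and> 0 \<le> ?e j + int (u j) then 0 else divided_coeff (?e j)) *
      (\<Prod>j\<in>S - T. divided_coeff (?e j))"
    by (simp only: pochhammer_divided_coeff)
  also have "\<dots> = (if \<exists>j\<in>T. ?e j < 0 \<and> 0 \<le> ?e j + int (u j) then 0
      else divided_monomial_coeff S e)"
  proof (cases "\<exists>j\<in>T. ?e j < 0 \<and> 0 \<le> ?e j + int (u j)")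
    case True
    then show ?thesis
      using fT by (auto simp: prod_zero_iff)
  next
    case False
    then have "(\<Prod>j\<in>T. if ?e j < 0 \<and> 0 \<le> ?e j + int (u j) then 0 else divided_coeff (?e j)) =
        (\<Prod>j\<in>T. divided_coeff (?e j))"
      by (intro prod.cong) auto
    then show ?thesis
      unfolding if_not_P[OF False]
      by (simp add: divided_monomial_coeff_def prod.subset_diff[OF assms(2,1)] mult.commute)
  qed
  also have "(\<exists>j\<in>T. ?e j < 0 \<and> 0 \<le> ?e j + int (u j)) \<longleftrightarrow>
      negative_support (e + exponent T u) \<noteq> negative_support e"
    using fT by (fastforce simp: negative_support_def lookup_add lookup_exponent set_eq_iff
        split: if_splits)
  finally show ?thesis
    by auto
qed

section \<open>The coefficients of the functions Psi\<close>

lemma prod_xpow: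
  assumes "finite S"
  shows "(\<Prod>j\<in>S. lscale (c j) (xpow j (int (u j)))) =
    Poly_Mapping.single (exponent S u) (\<Prod>j\<in>S. c j)"
  using assms
  by (induction S rule: finite_induct)
     (auto simp: exponent_def lscale_def xpow_def mult_single)

text \<open>
  A tuple of natural numbers indexed by \<open>S\<close> is the same as an exponent supported in \<open>S\<close> with
  empty negative support.
\<close>

lemma lookup_hyper_poly:
  assumes "finite S"
  shows "Poly_Mapping.lookup (hyper_poly S \<beta>) e =
    (if Poly_Mapping.keys e \<subseteq> S \<and> negative_support e = {} \<and>
        mat_app S (Poly_Mapping.lookup e) = \<beta>
     then divided_monomial_coeff S e else 0)"
proof -
  let ?u = "restrict (\<lambda>j. nat (Poly_Mapping.lookup e j)) S"
  let ?C = "Poly_Mapping.keys e \<subseteq> S \<and> negative_support e = {} \<and>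
    mat_app S (Poly_Mapping.lookup e) = \<beta>"
  have to_exponent: "?C \<and> u = ?u" if u: "u \<in> hyper_tuples S \<beta>" and "exponent S u = e" for u
  proof -
    have lookup_e: "Poly_Mapping.lookup e j = (if j \<in> S then int (u j) else 0)" for j
      using lookup_exponent[OF assms, of u] \<open>exponent S u = e\<close> by simp
    have "mat_app S (Poly_Mapping.lookup e) = mat_app S (int \<circ> u)"
      by (simp add: mat_app_def lookup_e)
    then have "mat_app S (Poly_Mapping.lookup e) = \<beta>"
      using u by (simp add: hyper_tuples_def)
    moreover have "u = ?u"
      using u by (auto simp: hyper_tuples_def lookup_e PiE_def extensional_def)
    moreover have "Poly_Mapping.keys e \<subseteq> S" "negative_support e = {}"
      by (auto simp: negative_support_def lookup_e in_keys_iff split: if_splits)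
    ultimately show ?thesis
      by blast
  qed
  have from_exponent: "?u \<in> hyper_tuples S \<beta> \<and> exponent S ?u = e" if ?C
  proof -
    have nonneg: "0 \<le> Poly_Mapping.lookup e j" for j
      using that by (auto simp: negative_support_def set_eq_iff not_less)
    have "mat_app S (int \<circ> ?u) = mat_app S (Poly_Mapping.lookup e)"
      by (simp add: mat_app_def nonneg)
    moreover have "exponent S ?u = e"
      using that
      by (intro poly_mapping_eqI) (auto simp: lookup_exponent[OF assms] nonneg in_keys_iff)
    ultimately show ?thesis
      using that by (simp add: hyper_tuples_def)
  qed
  have "Poly_Mapping.lookup (hyper_poly S \<beta>) e =
      (\<Sum>u\<in>hyper_tuples S \<beta>. if exponent S u = e then \<Prod>j\<in>S. 1 / fact (u j) else 0)"
    by (simp add: hyper_poly_def lookup_sum prod_xpow[OF assms] lookup_single when_def)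
  also have "\<dots> = (\<Sum>u\<in>{u \<in> hyper_tuples S \<beta>. exponent S u = e}. \<Prod>j\<in>S. 1 / fact (u j))"
    by (simp add: sum.inter_filter finite_hyper_tuples[OF assms])
  also have "{u \<in> hyper_tuples S \<beta>. exponent S u = e} = (if ?C then {?u} else {})"
  proof (cases ?C)
    case True
    then show ?thesis
      unfolding if_P[OF True] using to_exponent from_exponent by blast
  next
    case False
    then show ?thesis
      unfolding if_not_P[OF False] using to_exponent by blast
  qed
  also have "(\<Sum>u\<in>\<dots>. \<Prod>j\<in>S. 1 / fact (u j)) = (if ?C then divided_monomial_coeff S e else 0)"
  proof (cases ?C)
    case True
    then have "0 \<le> Poly_Mapping.lookup e j" for j
      by (auto simp: negative_support_def set_eq_iff not_less)
    then have "divided_monomial_coeff S e = (\<Prod>j\<in>S. 1 / fact (?u j))"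
      by (simp add: divided_monomial_coeff_def divided_coeff_def)
    then show ?thesis
      unfolding if_P[OF True] by simp
  next
    case False
    then show ?thesis
      unfolding if_not_P[OF False] by simp
  qed
  finally show ?thesis .
qed

text \<open>
  The index \<open>r\<close> of a summand is recovered from a monomial as minus its exponent at \<open>i\<close>, so
  different summands share no monomial. The finiteness assumption cannot be dropped here, because
  a sum over an infinite set of indices has the value \<open>0\<close>.
\<close>

lemma lookup_Psi:
  assumes "finite S" and "i \<in> S"
    and fin: "finite {r. 1 \<le> r \<and> hyper_poly (S - {i}) (\<alpha> + (int r, int r * int i)) \<noteq> 0}"
  shows "Poly_Mapping.lookup (Psi S i \<alpha>) e =
    (if Poly_Mapping.keys e \<subseteq> S \<and> negative_support e = {i} \<and>
        mat_app S (Poly_Mapping.lookup e) = \<alpha>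
     then divided_monomial_coeff S e else 0)"
    (is "_ = ?rhs")
proof -
  let ?e = "Poly_Mapping.lookup e"
  let ?f = "\<lambda>r. e + Poly_Mapping.single i (int r)"
  define R where "R = {r. 1 \<le> r \<and> hyper_poly (S - {i}) (\<alpha> + (int r, int r * int i)) \<noteq> 0}"
  define c where "c r = (-1) ^ r * fact (r - 1) *
    Poly_Mapping.lookup (hyper_poly (S - {i}) (\<alpha> + (int r, int r * int i))) (?f r)" for r :: nat
  have minus: "e - Poly_Mapping.single i (- int r) = ?f r" for r
    by (simp add: single_uminus)
  have "Poly_Mapping.lookup (Psi S i \<alpha>) e = (\<Sum>r\<in>R. c r)"
    unfolding Psi_def R_def c_def
    by (simp add: lookup_sum lookup_lscale mult.commute[of _ "xpow _ _"] lookup_xpow_times minus)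
  also have "\<dots> = (\<Sum>r\<in>R. if r = nat (- ?e i) then c r else 0)"
  proof (rule sum.cong[OF refl])
    fix r
    \<comment> \<open>otherwise the variable with index \<open>i\<close> would occur in a polynomial free of it\<close>
    have "c r = 0" if "r \<noteq> nat (- ?e i)" "r \<in> R"
    proof -
      from that have "?e i + int r \<noteq> 0"
        by auto
      then have "i \<in> Poly_Mapping.keys (?f r)"
        by (simp add: in_keys_iff lookup_add lookup_single)
      then show ?thesis
        using assms(1) by (auto simp: c_def lookup_hyper_poly)
    qed
    then show "c r = (if r = nat (- ?e i) then c r else 0)" if "r \<in> R"
      using that by auto
  qed
  also have "\<dots> = (if nat (- ?e i) \<in> R then c (nat (- ?e i)) else 0)"
    using fin by (simp add: R_def)
  also have "\<dots> = (if ?e i < 0 then c (nat (- ?e i)) else 0)"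
    by (auto simp: R_def c_def)
  also have "\<dots> = ?rhs"
  proof (cases "?e i < 0")
    case True
    define r where "r = nat (- ?e i)"
    have r: "int r = - ?e i" "r \<ge> 1"
      using True by (auto simp: r_def)
    have f: "Poly_Mapping.lookup (?f r) j = (if j = i then 0 else ?e j)" for j
      using r by (auto simp: lookup_add lookup_single when_def)
    have "Poly_Mapping.keys (?f r) \<subseteq> S - {i} \<longleftrightarrow> Poly_Mapping.keys e \<subseteq> S"
      using assms(2) by (auto simp: subset_iff in_keys_iff f)
    moreover have "negative_support (?f r) = {} \<longleftrightarrow> negative_support e = {i}"
      using True by (auto simp: negative_support_def f)
    moreover have "mat_app (S - {i}) (Poly_Mapping.lookup (?f r)) =
        mat_app S ?e + (int r, int r * int i)"
    proof -
      have "(\<Sum>j\<in>S - {i}. g j * Poly_Mapping.lookup (?f r) j) = (\<Sum>j\<in>S - {i}. g j * ?e j)"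
        for g :: "nat \<Rightarrow> int"
        by (rule sum.cong) (simp_all add: f)
      from this[of "\<lambda>_. 1"] this[of int] show ?thesis
        using assms(1,2) by (simp add: mat_app_def sum.remove[of S i] r(1))
    qed
    moreover have "(-1) ^ r * fact (r - 1) * divided_monomial_coeff (S - {i}) (?f r) =
        divided_monomial_coeff S e"
      using assms(1,2) True
      by (simp add: divided_monomial_coeff_def f prod.remove[of S i] divided_coeff_def[of "?e i"]
          flip: r_def)
    ultimately show ?thesis
      using True assms(1) unfolding r_def[symmetric] c_def
      by (auto simp: lookup_hyper_poly)
  qed (auto simp: negative_support_def)
  finally show ?thesis .
qed

lemma semigroup_I_iff:
  assumes "finite S"
  shows "\<alpha> \<in> semigroup_I S \<longleftrightarrow> (\<exists>e. Poly_Mapping.keys e \<subseteq> S \<and> negative_support e = {} \<and>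
    mat_app S (Poly_Mapping.lookup e) = \<alpha>)"
proof
  assume "\<alpha> \<in> semigroup_I S"
  then obtain u :: "nat \<Rightarrow> nat" where "mat_app S (int \<circ> u) = \<alpha>"
    by (auto simp: semigroup_I_def)
  then have "Poly_Mapping.keys (exponent S u) \<subseteq> S \<and> negative_support (exponent S u) = {} \<and>
      mat_app S (Poly_Mapping.lookup (exponent S u)) = \<alpha>"
    using assms by (auto simp: in_keys_iff negative_support_def lookup_exponent mat_app_def
        split: if_splits)
  then show "\<exists>e. Poly_Mapping.keys e \<subseteq> S \<and> negative_support e = {} \<and>
      mat_app S (Poly_Mapping.lookup e) = \<alpha>"
    by blast
next
  assume "\<exists>e. Poly_Mapping.keys e \<subseteq> S \<and> negative_support e = {} \<and>
    mat_app S (Poly_Mapping.lookup e) = \<alpha>"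
  then obtain e where e: "negative_support e = {}" "mat_app S (Poly_Mapping.lookup e) = \<alpha>"
    by blast
  from e have "mat_app S (int \<circ> (\<lambda>j. nat (Poly_Mapping.lookup e j))) = \<alpha>"
    by (auto simp: mat_app_def negative_support_def not_less)
  then show "\<alpha> \<in> semigroup_I S"
    unfolding semigroup_I_def by blast
qed

lemma mat_app_exponent:
  assumes "finite S" and "T \<subseteq> S"
  shows "mat_app S (Poly_Mapping.lookup (exponent T u)) = mat_app T (int \<circ> u)"
proof -
  have "finite T"
    using assms finite_subset by blast
  moreover have "(\<Sum>j\<in>S. if j \<in> T then f j else 0) = (\<Sum>j\<in>T. f j)" for f :: "nat \<Rightarrow> int"
    using assms by (simp add: sum.If_cases Int_absorb1)
  ultimately show ?thesis
    by (simp add: mat_app_def lookup_exponent if_distrib[of "(*) _"] cong: if_cong)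
qed

section \<open>The functions Psi are solutions\<close>

text \<open>
  A derivative keeps the terms whose negative support does not grow. Conversely a term of the
  right-hand side has negative support \<open>{i}\<close>, and the exponent it comes from has negative support
  contained in \<open>{i}\<close>, hence equal to it. The statement allows a subset \<open>T\<close> of the variables since
  both sides of a toric equation are such partial derivatives.
\<close>

lemma Dop_Psi:
  assumes "finite S" and "i \<in> S" and "T \<subseteq> S" and "\<alpha> \<notin> semigroup_I S"
    and fin: "\<And>\<alpha>. finite {r. 1 \<le> r \<and>
      hyper_poly (S - {i}) (\<alpha> + (int r, int r * int i)) \<noteq> 0}"
  shows "Dop T u (Psi S i \<alpha>) = Psi S i (\<alpha> - mat_app T (int \<circ> u))"
proof (rule poly_mapping_eqI)
  fix e
  have fT: "finite T"
    using assms finite_subset by blast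
  let ?e' = "e + exponent T u"
  have keys: "Poly_Mapping.keys ?e' \<subseteq> S \<longleftrightarrow> Poly_Mapping.keys e \<subseteq> S"
    using assms(3)
    by (auto simp: subset_iff in_keys_iff lookup_add lookup_exponent[OF fT] split: if_splits)
  have mat: "mat_app S (Poly_Mapping.lookup ?e') = \<alpha> \<longleftrightarrow>
      mat_app S (Poly_Mapping.lookup e) = \<alpha> - mat_app T (int \<circ> u)"
    by (auto simp: lookup_add[abs_def] mat_app_add mat_app_exponent[OF assms(1,3)])
  have sub: "negative_support ?e' \<subseteq> negative_support e"
    using fT by (auto simp: negative_support_def lookup_add lookup_exponent split: if_splits)
  \<comment> \<open>no exponent over \<open>\<alpha>\<close> has an empty negative support, so differentiation misses no term\<close>
  have ne: "negative_support ?e' \<noteq> {}"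
    if "Poly_Mapping.keys ?e' \<subseteq> S" "mat_app S (Poly_Mapping.lookup ?e') = \<alpha>"
    using that assms(4) semigroup_I_iff[OF assms(1)] by blast
  show "Poly_Mapping.lookup (Dop T u (Psi S i \<alpha>)) e =
      Poly_Mapping.lookup (Psi S i (\<alpha> - mat_app T (int \<circ> u))) e"
  proof (cases "Poly_Mapping.keys ?e' \<subseteq> S \<and> mat_app S (Poly_Mapping.lookup ?e') = \<alpha>")
    case False
    then show ?thesis
      by (auto simp: lookup_Dop[OF fT] lookup_Psi[OF assms(1,2) fin] keys mat)
  next
    case True
    have "Poly_Mapping.lookup (Dop T u (Psi S i \<alpha>)) e =
        (if negative_support ?e' = {i} \<and> negative_support ?e' = negative_support e
         then divided_monomial_coeff S e else 0)"
    proof (cases "negative_support ?e' = {i}")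
      case neg: True
      have "Poly_Mapping.lookup (Dop T u (Psi S i \<alpha>)) e =
          (\<Prod>j\<in>T. pochhammer (of_int (Poly_Mapping.lookup e j + 1)) (u j)) *
            divided_monomial_coeff S ?e'"
        using True neg by (simp add: lookup_Dop[OF fT] lookup_Psi[OF assms(1,2) fin])
      also have "\<dots> = (if negative_support ?e' = negative_support e
          then divided_monomial_coeff S e else 0)"
        by (rule pochhammer_divided_monomial_coeff[OF assms(1,3)])
      finally show ?thesis
        using neg by simp
    qed (simp add: lookup_Dop[OF fT] lookup_Psi[OF assms(1,2) fin])
    also have "\<dots> = (if negative_support e = {i} then divided_monomial_coeff S e else 0)"
      using True ne sub by auto
    also have "\<dots> = Poly_Mapping.lookup (Psi S i (\<alpha> - mat_app T (int \<circ> u))) e"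
      using True by (simp add: lookup_Psi[OF assms(1,2) fin] keys mat)
    finally show ?thesis .
  qed
qed

lemma mat_app_split_sign:
  assumes "finite S"
  shows "mat_app {j\<in>S. v j > 0} (int \<circ> (\<lambda>j. nat (v j))) -
    mat_app {j\<in>S. v j < 0} (int \<circ> (\<lambda>j. nat (- v j))) = mat_app S v"
proof -
  let ?P = "{j\<in>S. v j > 0}" and ?N = "{j\<in>S. v j < 0}"
  have sub: "?P \<subseteq> S" "?N \<subseteq> S" by auto
  have "Poly_Mapping.lookup (exponent ?P (\<lambda>j. nat (v j))) j -
      Poly_Mapping.lookup (exponent ?N (\<lambda>j. nat (- v j))) j = v j" if "j \<in> S" for j
    using assms that by (auto simp: lookup_exponent)
  then have "mat_app S v = mat_app S (\<lambda>j. Poly_Mapping.lookup (exponent ?P (\<lambda>j. nat (v j))) j -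
      Poly_Mapping.lookup (exponent ?N (\<lambda>j. nat (- v j))) j)"
    by (simp add: mat_app_def)
  also have "\<dots> = mat_app ?P (int \<circ> (\<lambda>j. nat (v j))) - mat_app ?N (int \<circ> (\<lambda>j. nat (- v j)))"
    by (simp add: mat_app_diff mat_app_exponent[OF assms sub(1)] mat_app_exponent[OF assms sub(2)])
  finally show ?thesis ..
qed

lemma Psi_hypergeometric_solution:
  assumes "finite S" and "i \<in> S" and "\<alpha> \<notin> semigroup_I S"
    and fin: "\<And>\<alpha>. finite {r. 1 \<le> r \<and>
      hyper_poly (S - {i}) (\<alpha> + (int r, int r * int i)) \<noteq> 0}"
  shows "Psi S i \<alpha> \<in> laurent_polys S" and "hypergeometric_solution S \<alpha> (Psi S i \<alpha>)"
proof -
  show "Psi S i \<alpha> \<in> laurent_polys S"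
    by (auto simp: laurent_polys_def in_keys_iff[of _ "Psi S i \<alpha>"]
        lookup_Psi[OF assms(1,2) fin] split: if_splits)
  have "Dop {j\<in>S. v j > 0} (\<lambda>j. nat (v j)) (Psi S i \<alpha>) =
      Dop {j\<in>S. v j < 0} (\<lambda>j. nat (- v j)) (Psi S i \<alpha>)" if "mat_app S v = 0" for v
  proof -
    have sub: "{j\<in>S. v j > 0} \<subseteq> S" "{j\<in>S. v j < 0} \<subseteq> S"
      by auto
    show ?thesis
      using mat_app_split_sign[OF assms(1), of v] that
      by (simp add: Dop_Psi[OF assms(1,2) sub(1) assms(3) fin]
          Dop_Psi[OF assms(1,2) sub(2) assms(3) fin])
  qed
  then show "hypergeometric_solution S \<alpha> (Psi S i \<alpha>)"
    by (auto simp: hypergeometric_solution_iff[OF assms(1)] in_keys_iff[of _ "Psi S i \<alpha>"]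
        lookup_Psi[OF assms(1,2) fin] split: if_splits)
qed

section \<open>Laurent polynomial solutions\<close>

text \<open>
  Consider the toric equation for $v = e_1 - e_2$ at the exponent $e = \min(e_1, e_2)$: the two sides
  involve only the coefficients at $e_1$ and $e_2$. The negative support of $e$ is the union of those
  of $e_1$ and $e_2$, which is that of $e_1$ here; so the side of $e_1$ survives, while the other one
  does only if the two negative supports agree.
\<close>

lemma solution_coeff_compare:
  assumes "finite S" and sol: "hypergeometric_solution S \<alpha> \<phi>"
    and keys: "Poly_Mapping.keys e1 \<subseteq> S" "Poly_Mapping.keys e2 \<subseteq> S"
    and mat: "mat_app S (Poly_Mapping.lookup e1) = mat_app S (Poly_Mapping.lookup e2)"
    and sub: "negative_support e2 \<subseteq> negative_support e1"
  shows "Poly_Mapping.lookup \<phi> e1 / divided_monomial_coeff S e1 =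
    (if negative_support e2 = negative_support e1
     then Poly_Mapping.lookup \<phi> e2 / divided_monomial_coeff S e2 else 0)"
proof -
  define v where "v j = Poly_Mapping.lookup e1 j - Poly_Mapping.lookup e2 j" for j
  define P N where "P = {j\<in>S. v j > 0}" and "N = {j\<in>S. v j < 0}"
  define p n where "p = (\<lambda>j. nat (v j))" and "n = (\<lambda>j. nat (- v j))"
  define e where "e = e1 - exponent P p"
  have PN: "P \<subseteq> S" "N \<subseteq> S" "finite P" "finite N"
    using assms(1) by (auto simp: P_def N_def)
  have zero: "Poly_Mapping.lookup e1 j = 0" "Poly_Mapping.lookup e2 j = 0" if "j \<notin> S" for j
    using keys that by (auto simp: subset_iff in_keys_iff)
  have min: "Poly_Mapping.lookup e j = min (Poly_Mapping.lookup e1 j) (Poly_Mapping.lookup e2 j)"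
    for j
    using PN zero[of j]
    by (cases "j \<in> S") (auto simp: e_def lookup_minus lookup_exponent P_def p_def v_def)
  have e1: "e + exponent P p = e1"
    by (simp add: e_def)
  have e2: "e + exponent N n = e2"
  proof (rule poly_mapping_eqI)
    fix j
    show "Poly_Mapping.lookup (e + exponent N n) j = Poly_Mapping.lookup e2 j"
      using PN zero[of j]
      by (cases "j \<in> S") (auto simp: lookup_add min lookup_exponent N_def n_def v_def)
  qed
  have neg: "negative_support e = negative_support e1"
    using sub by (auto simp: negative_support_def min min_less_iff_disj)
  have "mat_app S v = 0"
    using mat by (simp add: v_def[abs_def] mat_app_diff)
  with sol have "Dop P p \<phi> = Dop N n \<phi>"
    by (simp add: hypergeometric_solution_def P_def N_def p_def n_def)
  then have "Poly_Mapping.lookup (Dop P p \<phi>) e = Poly_Mapping.lookup (Dop N n \<phi>) e"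
    by simp
  then have eq: "(\<Prod>j\<in>P. pochhammer (of_int (Poly_Mapping.lookup e j + 1)) (p j)) * Poly_Mapping.lookup \<phi> e1 =
      (\<Prod>j\<in>N. pochhammer (of_int (Poly_Mapping.lookup e j + 1)) (n j)) * Poly_Mapping.lookup \<phi> e2"
    by (simp add: lookup_Dop PN e1 e2)
  have prod1: "(\<Prod>j\<in>P. pochhammer (of_int (Poly_Mapping.lookup e j + 1)) (p j)) =
      divided_monomial_coeff S e / divided_monomial_coeff S e1"
    using pochhammer_divided_monomial_coeff[OF assms(1) PN(1), of e p]
    by (simp add: e1 neg eq_divide_eq divided_monomial_coeff_nonzero assms(1))
  have prod2: "(\<Prod>j\<in>N. pochhammer (of_int (Poly_Mapping.lookup e j + 1)) (n j)) =
      (if negative_support e2 = negative_support e1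
       then divided_monomial_coeff S e / divided_monomial_coeff S e2 else 0)"
    using pochhammer_divided_monomial_coeff[OF assms(1) PN(2), of e n]
    by (simp add: e2 neg eq_divide_eq divided_monomial_coeff_nonzero assms(1) split: if_splits)
  show ?thesis
    using eq[unfolded prod1 prod2] divided_monomial_coeff_nonzero[OF assms(1)]
    by (cases "negative_support e2 = negative_support e1") (simp_all add: field_simps)
qed

text \<open>
  If the coefficient at \<open>e\<close> were nonzero, the comparison would give the same nonzero normalised
  coefficient at infinitely many exponents.
\<close>

lemma solution_coeff_zero_of_family:
  fixes f :: "nat \<Rightarrow> nat \<Rightarrow>\<^sub>0 int"
  assumes "finite S" and sol: "hypergeometric_solution S \<alpha> \<phi>"
    and "Poly_Mapping.keys e \<subseteq> S"
    and "inj f"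
    and "\<And>s. Poly_Mapping.keys (f s) \<subseteq> S"
    and "\<And>s. mat_app S (Poly_Mapping.lookup (f s)) = mat_app S (Poly_Mapping.lookup e)"
    and "\<And>s. negative_support (f s) \<subseteq> negative_support e"
  shows "Poly_Mapping.lookup \<phi> e = 0"
proof (rule ccontr)
  assume nz: "Poly_Mapping.lookup \<phi> e \<noteq> 0"
  have "f s \<in> Poly_Mapping.keys \<phi>" for s
    using solution_coeff_compare[OF assms(1) sol assms(3) assms(5) assms(6)[symmetric] assms(7), of s]
      nz divided_monomial_coeff_nonzero[OF assms(1)]
    by (auto simp: in_keys_iff split: if_splits)
  then have "range f \<subseteq> Poly_Mapping.keys \<phi>"
    by auto
  then have "finite (range f)"
    by (rule finite_subset) simp
  with \<open>inj f\<close> show False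
    using finite_imageD by blast
qed

text \<open>
  The \<open>s\<close>-fold multiple of the linear relation $(d-k)(1,0) + k(1,d) = d(1,k)$.
\<close>

definition kernel_vector :: "nat \<Rightarrow> nat \<Rightarrow> int \<Rightarrow> nat \<Rightarrow>\<^sub>0 int" where
  "kernel_vector d k s = Poly_Mapping.single 0 (s * (int d - int k)) +
     Poly_Mapping.single d (s * int k) - Poly_Mapping.single k (s * int d)"

lemma lookup_kernel_vector:
  assumes "0 < k" "k < d"
  shows "Poly_Mapping.lookup (kernel_vector d k s) j =
    (if j = 0 then s * (int d - int k) else if j = d then s * int k
     else if j = k then - s * int d else 0)"
  using assms by (auto simp: kernel_vector_def lookup_add lookup_minus lookup_single when_def)

lemma mat_app_kernel_vector:
  assumes "finite S" "0 < k" "k < d" "{0, k, d} \<subseteq> S"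
  shows "mat_app S (Poly_Mapping.lookup (kernel_vector d k s)) = 0"
proof -
  have "(\<Sum>j\<in>S. g j * Poly_Mapping.lookup (kernel_vector d k s) j) =
      (\<Sum>j\<in>{0, k, d}. g j * Poly_Mapping.lookup (kernel_vector d k s) j)" for g :: "nat \<Rightarrow> int"
    using assms by (intro sum.mono_neutral_right) (auto simp: lookup_kernel_vector)
  from this[of "\<lambda>_. 1"] this[of int] show ?thesis
    using assms by (simp add: mat_app_def lookup_kernel_vector algebra_simps zero_prod_def)
qed

lemma solution_coeff_zero_of_kernel_translates:
  fixes g :: "nat \<Rightarrow> int"
  assumes "finite S" and sol: "hypergeometric_solution S \<alpha> \<phi>"
    and "Poly_Mapping.keys e \<subseteq> S"
    and k: "0 < k" "k < d" "{0, k, d} \<subseteq> S"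
    and "inj g"
    and "\<And>s. negative_support (e + kernel_vector d k (g s)) \<subseteq> negative_support e"
  shows "Poly_Mapping.lookup \<phi> e = 0"
proof (rule solution_coeff_zero_of_family[OF assms(1-3)])
  show "inj (\<lambda>s. e + kernel_vector d k (g s))"
  proof (rule injI)
    fix s t
    assume "e + kernel_vector d k (g s) = e + kernel_vector d k (g t)"
    then have "Poly_Mapping.lookup (kernel_vector d k (g s)) d =
        Poly_Mapping.lookup (kernel_vector d k (g t)) d"
      by simp
    with k \<open>inj g\<close> show "s = t"
      by (simp add: lookup_kernel_vector inj_eq)
  qed
  show "Poly_Mapping.keys (e + kernel_vector d k (g s)) \<subseteq> S" for s
    using assms(3) k by (auto simp: subset_iff in_keys_iff lookup_add lookup_kernel_vector
        split: if_splits)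
  show "mat_app S (Poly_Mapping.lookup (e + kernel_vector d k (g s))) =
      mat_app S (Poly_Mapping.lookup e)" for s
    by (simp add: lookup_add[abs_def] mat_app_add mat_app_kernel_vector[OF assms(1) k])
qed (fact assms)

text \<open>
  Moving along the kernel vector of an interior \<open>k\<close> in the positive direction makes the entries at
  \<open>0\<close> and \<open>d\<close> nonnegative at the expense of the entry at \<open>k\<close>; this excludes negative entries at
  interior indices. The opposite direction raises the entry at \<open>k\<close> and only lowers those at \<open>0\<close>
  and \<open>d\<close>; this excludes that both of these are negative.
\<close>

lemma solution_negative_support:
  assumes "finite S" and sol: "hypergeometric_solution S \<alpha> \<phi>"
    and "\<phi> \<in> laurent_polys S" and "\<alpha> \<notin> semigroup_I S"
    and S: "{0, d} \<subseteq> S" and "S \<subseteq> {0..d}" and k: "k \<in> S" "0 < k" "k < d"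
    and e: "e \<in> Poly_Mapping.keys \<phi>"
  shows "negative_support e = {0} \<or> negative_support e = {d}"
proof -
  have keys: "Poly_Mapping.keys e \<subseteq> S"
    using assms(3) e by (auto simp: laurent_polys_def)
  have mat: "mat_app S (Poly_Mapping.lookup e) = \<alpha>"
    using sol e by (simp add: hypergeometric_solution_iff[OF assms(1)])
  have "negative_support e \<noteq> {}"
    using semigroup_I_iff[OF assms(1)] assms(4) keys mat by blast
  moreover have "negative_support e \<subseteq> {0, d}"
  proof
    fix j
    assume j: "j \<in> negative_support e"
    show "j \<in> {0, d}"
    proof (rule ccontr)
      assume "j \<notin> {0, d}"
      moreover have "j \<in> S"
        using j keys negative_support_subset_keys by blast
      ultimately have j': "0 < j" "j < d" "{0, j, d} \<subseteq> S"
        using S assms(6) by force+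
      \<comment> \<open>beyond this parameter the entries at \<open>0\<close> and \<open>d\<close> are nonnegative, as each grows
        by at least \<open>1\<close> per step\<close>
      define s0 where "s0 = \<bar>Poly_Mapping.lookup e 0\<bar> + \<bar>Poly_Mapping.lookup e d\<bar>"
      have "Poly_Mapping.lookup \<phi> e = 0"
      proof (rule solution_coeff_zero_of_kernel_translates[OF assms(1,2) keys j'])
        show "inj (\<lambda>s. s0 + int s)"
          by (simp add: inj_def)
        fix s
        let ?e = "Poly_Mapping.lookup e"
        let ?e' = "Poly_Mapping.lookup (e + kernel_vector d j (s0 + int s))"
        have ge: "s0 \<le> (s0 + int s) * c" if "c \<ge> 1" for c
        proof -
          have "0 \<le> s0"
            by (simp add: s0_def)
          then have "(s0 + int s) * 1 \<le> (s0 + int s) * c"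
            using that by (intro mult_left_mono) auto
          then show ?thesis
            by simp
        qed
        have "s0 \<le> (s0 + int s) * (int d - int j)" "s0 \<le> (s0 + int s) * int j"
          using j' by (auto intro!: ge)
        moreover have "- ?e 0 \<le> s0" "- ?e d \<le> s0"
          by (simp_all add: s0_def)
        moreover have "?e' 0 = ?e 0 + (s0 + int s) * (int d - int j)"
          "?e' d = ?e d + (s0 + int s) * int j"
          using j' by (simp_all add: lookup_add lookup_kernel_vector)
        ultimately have nonneg: "0 \<le> ?e' 0" "0 \<le> ?e' d"
          by linarith+
        show "negative_support (e + kernel_vector d j (s0 + int s)) \<subseteq> negative_support e"
        proof
          fix i
          assume "i \<in> negative_support (e + kernel_vector d j (s0 + int s))"
          then have neg: "?e' i < 0"
            by (simp add: negative_support_def)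
          show "i \<in> negative_support e"
          proof (cases "i \<in> {0, j, d}")
            case True
            with neg nonneg have "i = j"
              by force
            with j show ?thesis
              by simp
          next
            case False
            then have "?e' i = ?e i"
              using j' by (simp add: lookup_add lookup_kernel_vector)
            with neg show ?thesis
              by (simp add: negative_support_def)
          qed
        qed
      qed
      with e show False
        by (simp add: in_keys_iff)
    qed
  qed
  moreover have "negative_support e \<noteq> {0, d}"
  proof
    assume N: "negative_support e = {0, d}"
    have k': "{0, k, d} \<subseteq> S"
      using S k by auto
    have "Poly_Mapping.lookup \<phi> e = 0"
    proof (rule solution_coeff_zero_of_kernel_translates[OF assms(1,2) keys k(2,3) k'])
      show "inj (\<lambda>s. - int s)"
        by (simp add: inj_def)
      fix s
      have "k \<notin> negative_support e"
        using N k by auto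
      let ?e' = "Poly_Mapping.lookup (e + kernel_vector d k (- int s))"
      have nonneg: "0 \<le> ?e' k"
        using \<open>k \<notin> negative_support e\<close> k
        by (simp add: negative_support_def lookup_add lookup_kernel_vector)
      show "negative_support (e + kernel_vector d k (- int s)) \<subseteq> negative_support e"
      proof
        fix i
        assume "i \<in> negative_support (e + kernel_vector d k (- int s))"
        then have neg: "?e' i < 0"
          by (simp add: negative_support_def)
        show "i \<in> negative_support e"
        proof (cases "i \<in> {0, d}")
          case False
          moreover have "i \<noteq> k"
            using neg nonneg by auto
          ultimately have "?e' i = Poly_Mapping.lookup e i"
            using k by (simp add: lookup_add lookup_kernel_vector)
          with neg show ?thesis
            by (simp add: negative_support_def)
        qed (use N in simp)
      qed
    qed
    with e show False
      by (simp add: in_keys_iff)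
  qed
  ultimately show ?thesis
    by blast
qed

text \<open>
  On the exponents with negative support \<open>{i}\<close> the normalised coefficient of a solution is
  constant, and for \<open>Psi S i \<alpha>\<close> this constant is \<open>1\<close>; so \<open>c\<close> is the normalised coefficient of
  \<open>\<phi>\<close> at any such exponent.
\<close>

lemma solution_proportional_Psi:
  assumes "finite S" and sol: "hypergeometric_solution S \<alpha> \<phi>" and "i \<in> S"
    and fin: "finite {r. 1 \<le> r \<and> hyper_poly (S - {i}) (\<alpha> + (int r, int r * int i)) \<noteq> 0}"
  shows "\<exists>c. \<forall>e. Poly_Mapping.keys e \<subseteq> S \<and> negative_support e = {i} \<longrightarrow>
    Poly_Mapping.lookup \<phi> e = c * Poly_Mapping.lookup (Psi S i \<alpha>) e"
proof (cases "\<exists>e0. Poly_Mapping.keys e0 \<subseteq> S \<and> negative_support e0 = {i} \<and>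
    mat_app S (Poly_Mapping.lookup e0) = \<alpha>")
  case False
  show ?thesis
  proof (intro exI[of _ 0] allI impI, elim conjE)
    fix e
    assume "Poly_Mapping.keys e \<subseteq> S" "negative_support e = {i}"
    with False have "mat_app S (Poly_Mapping.lookup e) \<noteq> \<alpha>"
      by blast
    then show "Poly_Mapping.lookup \<phi> e = 0 * Poly_Mapping.lookup (Psi S i \<alpha>) e"
      using sol by (auto simp: hypergeometric_solution_iff[OF assms(1)] in_keys_iff)
  qed
next
  case True
  then obtain e0 where e0: "Poly_Mapping.keys e0 \<subseteq> S" "negative_support e0 = {i}"
    "mat_app S (Poly_Mapping.lookup e0) = \<alpha>"
    by blast
  show ?thesis
  proof (intro exI[of _ "Poly_Mapping.lookup \<phi> e0 / divided_monomial_coeff S e0"] allI impI,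
      elim conjE)
    fix e
    assume e: "Poly_Mapping.keys e \<subseteq> S" "negative_support e = {i}"
    show "Poly_Mapping.lookup \<phi> e = Poly_Mapping.lookup \<phi> e0 / divided_monomial_coeff S e0 *
        Poly_Mapping.lookup (Psi S i \<alpha>) e"
    proof (cases "mat_app S (Poly_Mapping.lookup e) = \<alpha>")
      case True
      then have "Poly_Mapping.lookup \<phi> e / divided_monomial_coeff S e =
          Poly_Mapping.lookup \<phi> e0 / divided_monomial_coeff S e0"
        using solution_coeff_compare[OF assms(1) sol e(1) e0(1)] e e0 by simp
      with True e show ?thesis
        using divided_monomial_coeff_nonzero[OF assms(1)]
        by (simp add: lookup_Psi[OF assms(1,3) fin] field_simps)
    next
      case False
      then have "Poly_Mapping.lookup \<phi> e = 0"
        using sol by (auto simp: hypergeometric_solution_iff[OF assms(1)] in_keys_iff)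
      with False show ?thesis
        by (simp add: lookup_Psi[OF assms(1,3) fin])
    qed
  qed
qed

section \<open>The span of the two functions\<close>

theorem theorem1p4:
  fixes m d :: nat and k :: "nat \<Rightarrow> nat" and \<Lambda> :: "nat set" and \<alpha> :: "int \<times> int"
  assumes "m \<ge> 1"
    and "strict_mono_on {1..m} k"
    and "\<And>i. i \<in> {1..m} \<Longrightarrow> 0 < k i \<and> k i < d"
    and "Gcd (insert d (k ` {1..m})) = 1"
    and "\<Lambda> = index_set m k d"
    and "\<alpha> \<notin> semigroup_I \<Lambda>"
  shows "(hypergeometric_solution \<Lambda> \<alpha> (Psi \<Lambda> d \<alpha>) \<and> hypergeometric_solution \<Lambda> \<alpha> (Psi \<Lambda> 0 \<alpha>)) \<and>
    (\<forall>u :: nat \<Rightarrow> nat.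
        Dop \<Lambda> u (Psi \<Lambda> d \<alpha>) = Psi \<Lambda> d (\<alpha> - mat_app \<Lambda> (int \<circ> u)) \<and>
        Dop \<Lambda> u (Psi \<Lambda> 0 \<alpha>) = Psi \<Lambda> 0 (\<alpha> - mat_app \<Lambda> (int \<circ> u))) \<and>
    laurent.span {Psi \<Lambda> d \<alpha>, Psi \<Lambda> 0 \<alpha>}
      = {\<phi> \<in> laurent_polys \<Lambda>. hypergeometric_solution \<Lambda> \<alpha> \<phi>}"
proof -
  have finS: "finite \<Lambda>" and mem: "d \<in> \<Lambda>" "0 \<in> \<Lambda>"
    by (auto simp: assms(5) index_set_def)
  have k1: "k 1 \<in> \<Lambda>" "0 < k 1" "k 1 < d"
    using assms(1,3) by (auto simp: assms(5) index_set_def)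
  have bound: "\<Lambda> \<subseteq> {0..d}"
    using assms(3) by (force simp: assms(5) index_set_def)
  have le: "j \<le> d" if "j \<in> \<Lambda>" for j
    using bound that by auto
  note find = finite_Psi_d[of \<Lambda> d, OF le]
  note fin0 = finite_Psi_0[of \<Lambda>]
  note sold = Psi_hypergeometric_solution[OF finS mem(1) assms(6) find]
  note sol0 = Psi_hypergeometric_solution[OF finS mem(2) assms(6) fin0]
  have "laurent.span {Psi \<Lambda> d \<alpha>, Psi \<Lambda> 0 \<alpha>} \<subseteq>
      {\<phi> \<in> laurent_polys \<Lambda>. hypergeometric_solution \<Lambda> \<alpha> \<phi>}"
    using sold sol0
    by (intro laurent.span_minimal subspace_hypergeometric_solutions finS) auto
  moreover have "\<phi> \<in> laurent.span {Psi \<Lambda> d \<alpha>, Psi \<Lambda> 0 \<alpha>}"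
    if \<phi>: "\<phi> \<in> laurent_polys \<Lambda>" "hypergeometric_solution \<Lambda> \<alpha> \<phi>" for \<phi>
  proof -
    obtain a where a: "\<forall>e. Poly_Mapping.keys e \<subseteq> \<Lambda> \<and> negative_support e = {d} \<longrightarrow>
        Poly_Mapping.lookup \<phi> e = a * Poly_Mapping.lookup (Psi \<Lambda> d \<alpha>) e"
      using solution_proportional_Psi[OF finS \<phi>(2) mem(1) find] by blast
    obtain b where b: "\<forall>e. Poly_Mapping.keys e \<subseteq> \<Lambda> \<and> negative_support e = {0} \<longrightarrow>
        Poly_Mapping.lookup \<phi> e = b * Poly_Mapping.lookup (Psi \<Lambda> 0 \<alpha>) e"
      using solution_proportional_Psi[OF finS \<phi>(2) mem(2) fin0] by blast
    have "\<phi> = lscale a (Psi \<Lambda> d \<alpha>) + lscale b (Psi \<Lambda> 0 \<alpha>)"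
    proof (rule poly_mapping_eqI)
      fix e
      consider "Poly_Mapping.keys e \<subseteq> \<Lambda>" "negative_support e = {d}"
        | "Poly_Mapping.keys e \<subseteq> \<Lambda>" "negative_support e = {0}"
        | "\<not> (Poly_Mapping.keys e \<subseteq> \<Lambda> \<and>
            (negative_support e = {0} \<or> negative_support e = {d}))"
        by metis
      then show "Poly_Mapping.lookup \<phi> e =
          Poly_Mapping.lookup (lscale a (Psi \<Lambda> d \<alpha>) + lscale b (Psi \<Lambda> 0 \<alpha>)) e"
      proof cases
        case 1
        then show ?thesis
          using k1 a by (simp add: lookup_add lookup_lscale lookup_Psi[OF finS mem(2) fin0])
      next
        case 2
        then show ?thesis
          using k1 b by (simp add: lookup_add lookup_lscale lookup_Psi[OF finS mem(1) find])
      next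
        case 3
        have "e \<notin> Poly_Mapping.keys \<phi>"
        proof
          assume e: "e \<in> Poly_Mapping.keys \<phi>"
          then have "Poly_Mapping.keys e \<subseteq> \<Lambda>"
            using \<phi>(1) by (simp add: laurent_polys_def)
          moreover have "negative_support e = {0} \<or> negative_support e = {d}"
            using mem by (intro solution_negative_support[OF finS \<phi>(2,1) assms(6) _ bound k1 e]) simp
          ultimately show False
            using 3 by simp
        qed
        moreover have "Poly_Mapping.lookup (Psi \<Lambda> d \<alpha>) e = 0"
          "Poly_Mapping.lookup (Psi \<Lambda> 0 \<alpha>) e = 0"
          using 3 lookup_Psi[OF finS mem(1) find, of \<alpha> e] lookup_Psi[OF finS mem(2) fin0, of \<alpha> e]
          by (metis (no_types, lifting))+
        ultimately show ?thesis
          by (simp add: in_keys_iff lookup_add lookup_lscale)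
      qed
    qed
    moreover have "lscale a (Psi \<Lambda> d \<alpha>) + lscale b (Psi \<Lambda> 0 \<alpha>) \<in>
        laurent.span {Psi \<Lambda> d \<alpha>, Psi \<Lambda> 0 \<alpha>}"
      by (intro laurent.span_add laurent.span_scale laurent.span_base) auto
    ultimately show ?thesis
      by simp
  qed
  ultimately have "laurent.span {Psi \<Lambda> d \<alpha>, Psi \<Lambda> 0 \<alpha>} =
      {\<phi> \<in> laurent_polys \<Lambda>. hypergeometric_solution \<Lambda> \<alpha> \<phi>}"
    by blast
  with sold(2) sol0(2) Dop_Psi[OF finS mem(1) subset_refl assms(6) find]
    Dop_Psi[OF finS mem(2) subset_refl assms(6) fin0]
  show ?thesis
    by blast
qed

end
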